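(* Let $e_0,e_3,e_4\in\mathbb{C}^*$ satisfy $e_0\neq\pm1$, $e_3\neq\pm1$, $e_4\neq\pm1$ and $e_0e_3^{\varepsilon_3}e_4^{\varepsilon_4}\neq1$ for all $\varepsilon_3,\varepsilon_4\in\{1,-1\}$, and let $\kappa\in\mathbb{C}^*$. For each sign $\pm$, the confluent morphism $\Phi_\kappa^\pm:\mathcal{C}_V(\theta^\pm)\to\mathcal{C}_{VI}(\kappa(\theta^\pm))$ defined in the context is a symplectic birational morphism from $(\mathcal{C}_V(\theta^\pm),\omega_V)$ to $(\mathcal{C}_{VI}(\kappa(\theta^\pm)),\omega_{VI})$.
   Context: Put $a_3=e_3+e_3^{-1}$, $a_4=e_4+e_4^{-1}$, and $\epsilon=e_0$ for the sign $+$, $\epsilon=e_0^{-1}$ for the sign $-$. Source surface: $\theta_1=a_3+\epsilon a_4$, $\theta_2=a_4+\epsilon a_3$, $\theta_3=\epsilon$, $\theta_4=\epsilon^2+\epsilon a_3a_4+1$, and $\mathcal{C}_V(\theta^\pm)\subset\mathbb{C}^3$ is $F_V=x_1x_2x_3+x_1^2+x_2^2-\theta_1x_1-\theta_2x_2-\theta_3x_3+\theta_4=0$, with symplectic form $\omega_V=\frac{dx_1\wedge dx_2}{\partial F_V/\partial x_3}=\frac{dx_2\wedge dx_3}{\partial F_V/\partial x_1}=\frac{dx_3\wedge dx_1}{\partial F_V/\partial x_2}$. Target surface: $b_1=\kappa+\kappa^{-1}$, $b_2=\epsilon\kappa^{-1}+\epsilon^{-1}\kappa$, $b_3=a_3$,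 $b_4=a_4$, $\Theta_i=b_ib_4+b_jb_k$ for $\{i,j,k\}=\{1,2,3\}$, $\Theta_4=b_1b_2b_3b_4+\sum_{i=1}^4 b_i^2-4$, and $\mathcal{C}_{VI}(\kappa(\theta^\pm))\subset\mathbb{C}^3$ is $F_{VI}=x_1x_2x_3+x_1^2+x_2^2+x_3^2-\Theta_1x_1-\Theta_2x_2-\Theta_3x_3+\Theta_4=0$, with symplectic form $\omega_{VI}=\frac{dx_1\wedge dx_2}{\partial F_{VI}/\partial x_3}=\frac{dx_2\wedge dx_3}{\partial F_{VI}/\partial x_1}=\frac{dx_3\wedge dx_1}{\partial F_{VI}/\partial x_2}$. Definition of $\Phi_\kappa^\pm$. Consider tuples of matrices in $SL_2(\mathbb{C})$: $U_1=\begin{pmatrix} 1 & 0 \\ u_1 & 1 \end{pmatrix}$, $M_0=\mathrm{diag}(\epsilon,\epsilon^{-1})$, $U_2=\begin{pmatrix} 1 & u_2 \\ 0 & 1 \end{pmatrix}$, $M_3,M_4$ with $\mathrm{tr}\,M_3=a_3$, $\mathrm{tr}\,M_4=a_4$ and $U_1M_0U_2M_3M_4=I$, up to simultaneous conjugation by diagonal matrices of $SL_2(\mathbb{C})$. The functions $x_1=(M_3)_{22}$, $x_2=(M_4)_{22}$, $x_3=\mathrm{tr}(U_1M_0U_2)$ take values in $\mathcal{C}_V(\theta^\pm)$, and a generic point of $\mathcal{C}_V(\theta^\pm)$ comes from a unique such class. With $D_\kappa=\mathrm{diag}(\kappa,\kappa^{-1})$, set $M_1=U_1D_\kappa$, $M_2=D_\kappa^{-1}M_0U_2$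 (so that $M_1M_2M_3M_4=I$). Then $\Phi_\kappa^\pm$ sends the point $(x_1,x_2,x_3)$ of $\mathcal{C}_V(\theta^\pm)$ corresponding to the class of $(U_1,M_0,U_2,M_3,M_4)$ to the point $(\mathrm{tr}(M_2M_3),\mathrm{tr}(M_3M_1),\mathrm{tr}(M_1M_2))$ of $\mathcal{C}_{VI}(\kappa(\theta^\pm))$.
   Formalization: With the forms as given, the pullback of ω_VI under Φ_κ is −ω_V (F_VI∘Φ = −J·F_V, J the Jacobian), so literal preservation fails for all parameters; the result proved is that Φ_κ is a symplectic birational morphism from (C_V, −ω_V) to (C_VI, ω_VI). *)

theory Defs
  imports "HOL-Analysis.Analysis" "HOL-Computational_Algebra.Polynomial"
begin

section \<open>Polynomials in three variables\<close>

text \<open>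
  The ring of polynomials in three variables over the complex numbers is represented by nested
  univariate polynomials: the outermost indeterminate is the first variable, the innermost one
  the third.
\<close>

type_synonym poly3 = "complex poly poly poly"

definition cst :: "complex \<Rightarrow> poly3" where
  "cst c = [:[:[:c:]:]:]"

definition X1 :: poly3 where "X1 = [:0, 1:]"
definition X2 :: poly3 where "X2 = [:[:0, 1:]:]"
definition X3 :: poly3 where "X3 = [:[:[:0, 1:]:]:]"

definition eval3 :: "poly3 \<Rightarrow> complex^3 \<Rightarrow> complex" where
  "eval3 p x = poly (poly (poly p [:[:x$1:]:]) [:x$2:]) (x$3)"

definition pdiff :: "3 \<Rightarrow> poly3 \<Rightarrow> poly3" where
  "pdiff i p = (if i = 1 then pderiv p
                else if i = 2 then map_poly pderiv p
                else map_poly (map_poly pderiv) p)"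

text \<open>The differential of a polynomial, and of a polynomial self-map of the affine space, at
  the point \<open>x\<close> in the direction \<open>v\<close>.\<close>

definition dpoly :: "poly3 \<Rightarrow> complex^3 \<Rightarrow> complex^3 \<Rightarrow> complex" where
  "dpoly p x v = (\<Sum>i\<in>UNIV. eval3 (pdiff i p) x * v$i)"

definition eval_map :: "(3 \<Rightarrow> poly3) \<Rightarrow> complex^3 \<Rightarrow> complex^3" where
  "eval_map P x = (\<chi> i. eval3 (P i) x)"

definition dpoly_map :: "(3 \<Rightarrow> poly3) \<Rightarrow> complex^3 \<Rightarrow> complex^3 \<Rightarrow> complex^3" where
  "dpoly_map P x v = (\<chi> i. dpoly (P i) x v)"

lemma eval3_simps [simp]:
  "eval3 0 x = 0" "eval3 1 x = 1"
  "eval3 (p + q) x = eval3 p x + eval3 q x"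
  "eval3 (p - q) x = eval3 p x - eval3 q x"
  "eval3 (- p) x = - eval3 p x"
  "eval3 (p * q) x = eval3 p x * eval3 q x"
  "eval3 (p ^ n) x = eval3 p x ^ n"
  "eval3 (cst c) x = c"
  "eval3 X1 x = x$1" "eval3 X2 x = x$2" "eval3 X3 x = x$3"
  by (simp_all add: eval3_def cst_def X1_def X2_def X3_def)


section \<open>Zariski topology, regular maps, birational maps\<close>

definition zeros :: "poly3 set \<Rightarrow> (complex^3) set" where
  "zeros T = {x. \<forall>p\<in>T. eval3 p x = 0}"

definition zariski :: "(complex^3) topology" where
  "zariski = topology (\<lambda>U. \<exists>T. U = - zeros T)"

lemma openin_zariski: "openin zariski U \<longleftrightarrow> (\<exists>T. U = - zeros T)"
proof -
  have "istopology (\<lambda>U. \<exists>T. U = - zeros T)"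
    unfolding istopology_def
  proof (intro conjI allI impI)
    fix S S' assume "\<exists>T. S = - zeros T" "\<exists>T. S' = - zeros T"
    then obtain T T' where T: "S = - zeros T" "S' = - zeros T'" by blast
    have "S \<inter> S' = - zeros {p * q | p q. p \<in> T \<and> q \<in> T'}"
      unfolding T zeros_def by fastforce
    then show "\<exists>T. S \<inter> S' = - zeros T" by blast
  next
    fix K assume "\<forall>S\<in>K. \<exists>T. S = - zeros T"
    then obtain f where f: "\<And>S. S \<in> K \<Longrightarrow> S = - zeros (f S)" by metis
    have "\<Union>K = (\<Union>S\<in>K. - zeros (f S))" using f by blast
    also have "\<dots> = - zeros (\<Union>(f ` K))" by (auto simp: zeros_def)
    finally show "\<exists>T. \<Union>K = - zeros T" by blast
  qed
  then show ?thesis by (simp add: zariski_def)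
qed

definition regular_fun :: "(complex^3) set \<Rightarrow> (complex^3 \<Rightarrow> complex) \<Rightarrow> bool" where
  "regular_fun V f \<longleftrightarrow>
     (\<forall>v\<in>V. \<exists>N g h. openin (subtopology zariski V) N \<and> v \<in> N \<and>
        (\<forall>w\<in>N. eval3 h w \<noteq> 0 \<and> f w = eval3 g w / eval3 h w))"

definition regular_map ::
    "(complex^3) set \<Rightarrow> (complex^3) set \<Rightarrow> (complex^3 \<Rightarrow> complex^3) \<Rightarrow> bool" where
  "regular_map V W f \<longleftrightarrow> f ` V \<subseteq> W \<and> (\<forall>i. regular_fun V (\<lambda>x. f x $ i))"

text \<open>Morphisms of closed subvarieties of the affine space are restrictions of polynomial maps.\<close>

definition affine_morphism ::
    "(complex^3) set \<Rightarrow> (complex^3) set \<Rightarrow> (complex^3 \<Rightarrow> complex^3) \<Rightarrow> bool" where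
  "affine_morphism X Y f \<longleftrightarrow> f ` X \<subseteq> Y \<and> (\<exists>P. \<forall>x\<in>X. f x = eval_map P x)"

definition dense_open :: "(complex^3) set \<Rightarrow> (complex^3) set \<Rightarrow> bool" where
  "dense_open X U \<longleftrightarrow> openin (subtopology zariski X) U \<and> (subtopology zariski X) closure_of U = X"

definition birational ::
    "(complex^3) set \<Rightarrow> (complex^3) set \<Rightarrow> (complex^3 \<Rightarrow> complex^3) \<Rightarrow> bool" where
  "birational X Y f \<longleftrightarrow>
     (\<exists>U V g. dense_open X U \<and> dense_open Y V \<and> regular_map U V f \<and> regular_map V U g \<and>
        (\<forall>x\<in>U. g (f x) = x) \<and> (\<forall>y\<in>V. f (g y) = y))"


section \<open>Surfaces and their two-forms\<close>

definition surface :: "poly3 \<Rightarrow> (complex^3) set" where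
  "surface F = {x. eval3 F x = 0}"

definition smooth_points :: "poly3 \<Rightarrow> (complex^3) set" where
  "smooth_points F = {x \<in> surface F. \<exists>i. eval3 (pdiff i F) x \<noteq> 0}"

definition tangent_space :: "poly3 \<Rightarrow> complex^3 \<Rightarrow> (complex^3) set" where
  "tangent_space F x = {v. dpoly F x v = 0}"

type_synonym two_form = "complex^3 \<Rightarrow> complex^3 \<Rightarrow> complex^3 \<Rightarrow> complex"

text \<open>
  The form \<open>dx1 \<and> dx2 / (\<partial>F/\<partial>x3) = dx2 \<and> dx3 / (\<partial>F/\<partial>x1) = dx3 \<and> dx1 / (\<partial>F/\<partial>x2)\<close> at \<open>x\<close>,
  evaluated on tangent vectors \<open>v\<close>, \<open>w\<close>. At a smooth point at least one denominator is nonzero,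
  and all the expressions that are defined there agree on the tangent space.
\<close>

definition omega :: "poly3 \<Rightarrow> two_form" where
  "omega F x v w =
     (if eval3 (pdiff 3 F) x \<noteq> 0 then (v$1 * w$2 - v$2 * w$1) / eval3 (pdiff 3 F) x
      else if eval3 (pdiff 1 F) x \<noteq> 0 then (v$2 * w$3 - v$3 * w$2) / eval3 (pdiff 1 F) x
      else (v$3 * w$1 - v$1 * w$3) / eval3 (pdiff 2 F) x)"

lemma omega_eq:
  assumes "v \<in> tangent_space F x" "w \<in> tangent_space F x"
  shows "eval3 (pdiff 3 F) x \<noteq> 0 \<Longrightarrow>
           omega F x v w = (v$1 * w$2 - v$2 * w$1) / eval3 (pdiff 3 F) x"
    and "eval3 (pdiff 1 F) x \<noteq> 0 \<Longrightarrow>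
           omega F x v w = (v$2 * w$3 - v$3 * w$2) / eval3 (pdiff 1 F) x"
    and "eval3 (pdiff 2 F) x \<noteq> 0 \<Longrightarrow>
           omega F x v w = (v$3 * w$1 - v$1 * w$3) / eval3 (pdiff 2 F) x"
proof -
  define a b c where abc: "a = eval3 (pdiff 1 F) x" "b = eval3 (pdiff 2 F) x" "c = eval3 (pdiff 3 F) x"
  have "a * v$1 + b * v$2 + c * v$3 = 0" "a * w$1 + b * w$2 + c * w$3 = 0"
    using assms unfolding tangent_space_def dpoly_def abc by (simp_all add: sum_3)
  then have "c * (v$2 * w$3 - v$3 * w$2) = a * (v$1 * w$2 - v$2 * w$1)"
    "b * (v$2 * w$3 - v$3 * w$2) = a * (v$3 * w$1 - v$1 * w$3)"
    "c * (v$3 * w$1 - v$1 * w$3) = b * (v$1 * w$2 - v$2 * w$1)"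
    by algebra+
  then show "eval3 (pdiff 3 F) x \<noteq> 0 \<Longrightarrow>
           omega F x v w = (v$1 * w$2 - v$2 * w$1) / eval3 (pdiff 3 F) x"
    and "eval3 (pdiff 1 F) x \<noteq> 0 \<Longrightarrow>
           omega F x v w = (v$2 * w$3 - v$3 * w$2) / eval3 (pdiff 1 F) x"
    and "eval3 (pdiff 2 F) x \<noteq> 0 \<Longrightarrow>
           omega F x v w = (v$3 * w$1 - v$1 * w$3) / eval3 (pdiff 2 F) x"
    unfolding omega_def abc[symmetric] by (auto simp: field_simps)
qed

text \<open>
  The pullback of \<open>\<eta>\<close> by \<open>f\<close> is \<open>\<omega>\<close>. The differential of \<open>f\<close> at a point of \<open>surface F\<close> is the
  restriction to the tangent space of the differential of any polynomial map representing \<open>f\<close>;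
  the condition is imposed for every such representative.
\<close>

definition symplectic_map ::
    "poly3 \<Rightarrow> two_form \<Rightarrow> poly3 \<Rightarrow> two_form \<Rightarrow> (complex^3 \<Rightarrow> complex^3) \<Rightarrow> bool" where
  "symplectic_map F \<omega> G \<eta> f \<longleftrightarrow>
     (\<forall>P x v w. (\<forall>y\<in>surface F. f y = eval_map P y) \<longrightarrow>
        x \<in> smooth_points F \<longrightarrow> f x \<in> smooth_points G \<longrightarrow>
        v \<in> tangent_space F x \<longrightarrow> w \<in> tangent_space F x \<longrightarrow>
        \<eta> (f x) (dpoly_map P x v) (dpoly_map P x w) = \<omega> x v w)"

definition symplectic_birational_morphism ::
    "poly3 \<Rightarrow> two_form \<Rightarrow> poly3 \<Rightarrow> two_form \<Rightarrow> (complex^3 \<Rightarrow> complex^3) \<Rightarrow> bool" where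
  "symplectic_birational_morphism F \<omega> G \<eta> f \<longleftrightarrow>
     affine_morphism (surface F) (surface G) f \<and>
     birational (surface F) (surface G) f \<and>
     symplectic_map F \<omega> G \<eta> f"


section \<open>The two character varieties\<close>

definition F_V :: "complex \<Rightarrow> complex \<Rightarrow> complex \<Rightarrow> poly3" where
  "F_V \<epsilon> a3 a4 =
     (let \<theta>1 = a3 + \<epsilon> * a4; \<theta>2 = a4 + \<epsilon> * a3; \<theta>3 = \<epsilon>; \<theta>4 = \<epsilon>^2 + \<epsilon> * a3 * a4 + 1
      in X1 * X2 * X3 + X1^2 + X2^2 - cst \<theta>1 * X1 - cst \<theta>2 * X2 - cst \<theta>3 * X3 + cst \<theta>4)"

definition F_VI :: "complex \<Rightarrow> complex \<Rightarrow> complex \<Rightarrow> complex \<Rightarrow> poly3" where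
  "F_VI b1 b2 b3 b4 =
     (let \<Theta>1 = b1 * b4 + b2 * b3; \<Theta>2 = b2 * b4 + b3 * b1; \<Theta>3 = b3 * b4 + b1 * b2;
          \<Theta>4 = b1 * b2 * b3 * b4 + (b1^2 + b2^2 + b3^2 + b4^2) - 4
      in X1 * X2 * X3 + X1^2 + X2^2 + X3^2
           - cst \<Theta>1 * X1 - cst \<Theta>2 * X2 - cst \<Theta>3 * X3 + cst \<Theta>4)"

text \<open>The target surface, with the parameters prescribed by \<open>\<kappa>\<close>.\<close>

definition F_VI_kappa :: "complex \<Rightarrow> complex \<Rightarrow> complex \<Rightarrow> complex \<Rightarrow> poly3" where
  "F_VI_kappa \<kappa> \<epsilon> a3 a4 =
     F_VI (\<kappa> + inverse \<kappa>) (\<epsilon> * inverse \<kappa> + inverse \<epsilon> * \<kappa>) a3 a4"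


section \<open>The confluent morphism\<close>

definition mat2 :: "complex \<Rightarrow> complex \<Rightarrow> complex \<Rightarrow> complex \<Rightarrow> complex^2^2" where
  "mat2 a b c d = vector [vector [a, b], vector [c, d]]"

type_synonym matrix_tuple =
  "(complex^2^2) \<times> (complex^2^2) \<times> (complex^2^2) \<times> (complex^2^2) \<times> (complex^2^2)"

definition monodromy_tuple :: "complex \<Rightarrow> complex \<Rightarrow> complex \<Rightarrow> matrix_tuple \<Rightarrow> bool" where
  "monodromy_tuple \<epsilon> a3 a4 = (\<lambda>(U1, M0, U2, M3, M4).
     (\<exists>u1. U1 = mat2 1 0 u1 1) \<and> M0 = mat2 \<epsilon> 0 0 (inverse \<epsilon>) \<and> (\<exists>u2. U2 = mat2 1 u2 0 1) \<and>
     det M3 = 1 \<and> det M4 = 1 \<and> trace M3 = a3 \<and> trace M4 = a4 \<and>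
     U1 ** M0 ** U2 ** M3 ** M4 = mat 1)"

definition coords_V :: "matrix_tuple \<Rightarrow> complex^3" where
  "coords_V = (\<lambda>(U1, M0, U2, M3, M4). vector [M3$2$2, M4$2$2, trace (U1 ** M0 ** U2)])"

definition coords_VI :: "complex \<Rightarrow> matrix_tuple \<Rightarrow> complex^3" where
  "coords_VI \<kappa> = (\<lambda>(U1, M0, U2, M3, M4).
     let M1 = U1 ** mat2 \<kappa> 0 0 (inverse \<kappa>);
         M2 = mat2 (inverse \<kappa>) 0 0 \<kappa> ** M0 ** U2
     in vector [trace (M2 ** M3), trace (M3 ** M1), trace (M1 ** M2)])"

text \<open>
  Simultaneous conjugation by diagonal matrices changes neither \<open>coords_V\<close> nor \<open>coords_VI\<close>, so
  the correspondence is formulated with representatives of the classes. It determines the value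
  at every point of the source surface, not only at generic ones; see the lemmas
  \<open>confluent_map_coords\<close> and \<open>ex_monodromy_tuple\<close>.
\<close>

definition confluent_map ::
    "complex \<Rightarrow> complex \<Rightarrow> complex \<Rightarrow> complex \<Rightarrow> complex^3 \<Rightarrow> complex^3" where
  "confluent_map \<kappa> \<epsilon> a3 a4 x =
     (THE y. \<exists>t. monodromy_tuple \<epsilon> a3 a4 t \<and> coords_V t = x \<and> coords_VI \<kappa> t = y)"

lemma mat2_nth [simp]:
  "mat2 a b c d $ 1 $ 1 = a" "mat2 a b c d $ 1 $ 2 = b"
  "mat2 a b c d $ 2 $ 1 = c" "mat2 a b c d $ 2 $ 2 = d"
  by (simp_all add: mat2_def)

lemma mat2_eq: "A = mat2 (A$1$1) (A$1$2) (A$2$1) (A$2$2)"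
  by (simp add: vec_eq_iff forall_2)

lemma mat2_simps:
  "mat2 a b c d ** mat2 a' b' c' d' =
     mat2 (a * a' + b * c') (a * b' + b * d') (c * a' + d * c') (c * b' + d * d')"
  "trace (mat2 a b c d) = a + d" "det (mat2 a b c d) = a * d - b * c" "mat 1 = mat2 1 0 0 1"
  "mat2 a b c d = mat2 a' b' c' d' \<longleftrightarrow> a = a' \<and> b = b' \<and> c = c' \<and> d = d'"
  by (auto simp: vec_eq_iff forall_2 matrix_matrix_mult_def sum_2 trace_def det_2 mat_def)

lemma monodromy_tuple_coords:
  assumes t: "monodromy_tuple \<epsilon> a3 a4 t" and "\<epsilon> \<noteq> 0" "\<kappa> \<noteq> 0"
  shows "coords_V t \<in> surface (F_V \<epsilon> a3 a4)"
    and "coords_VI \<kappa> t = (let x = coords_V t in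
           vector [\<kappa> / \<epsilon> * x$1 + x$2 / \<kappa>,
                   \<kappa> * a3 + \<kappa> / \<epsilon> * (a4 - x$2 - x$1 * x$3) + x$1 / \<kappa>,
                   x$3])"
proof -
  obtain U1 M0 U2 M3 M4 where tt: "t = (U1, M0, U2, M3, M4)" by (metis prod_cases5)
  define e where "e = inverse \<epsilon>"
  have e: "\<epsilon> * e = 1" using assms by (simp add: e_def)
  obtain m p q x1 where M3: "M3 = mat2 m p q x1" using mat2_eq by blast
  obtain r s l x2 where M4: "M4 = mat2 r s l x2" using mat2_eq by blast
  obtain u1 where U1: "U1 = mat2 1 0 u1 1" using t by (auto simp: tt monodromy_tuple_def)
  obtain u2 where U2: "U2 = mat2 1 u2 0 1" using t by (auto simp: tt monodromy_tuple_def)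
  have M0: "M0 = mat2 \<epsilon> 0 0 e" using t by (auto simp: tt monodromy_tuple_def e_def)
  have c: "m * x1 - p * q = 1" "r * x2 - s * l = 1" "m + x1 = a3" "r + x2 = a4"
    using t by (auto simp: tt monodromy_tuple_def M3 M4 mat2_simps)
  have "mat2 1 0 u1 1 ** mat2 \<epsilon> 0 0 e ** mat2 1 u2 0 1 ** mat2 m p q x1 ** mat2 r s l x2 = mat2 1 0 0 1"
    using t by (auto simp: tt monodromy_tuple_def M3 M4 U1 U2 M0 mat2_simps(4))
  then have pr:
    "(\<epsilon> * m + \<epsilon> * u2 * q) * r + (\<epsilon> * p + \<epsilon> * u2 * x1) * l = 1"
    "(\<epsilon> * m + \<epsilon> * u2 * q) * s + (\<epsilon> * p + \<epsilon> * u2 * x1) * x2 = 0"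
    "(u1 * \<epsilon> * m + (u1 * \<epsilon> * u2 + e) * q) * r + (u1 * \<epsilon> * p + (u1 * \<epsilon> * u2 + e) * x1) * l = 0"
    "(u1 * \<epsilon> * m + (u1 * \<epsilon> * u2 + e) * q) * s + (u1 * \<epsilon> * p + (u1 * \<epsilon> * u2 + e) * x1) * x2 = 1"
    by (simp_all add: mat2_simps)
  define K11 K12 K21 K22 where K: "K11 = m * r + p * l" "K12 = m * s + p * x2"
    "K21 = q * r + x1 * l" "K22 = q * s + x1 * x2"
  have k: "\<epsilon> * K11 + \<epsilon> * u2 * K21 = 1" "\<epsilon> * K12 + \<epsilon> * u2 * K22 = 0"
    "u1 * \<epsilon> * K11 + (u1 * \<epsilon> * u2 + e) * K21 = 0" "u1 * \<epsilon> * K12 + (u1 * \<epsilon> * u2 + e) * K22 = 1"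
    using pr unfolding K by (simp_all add: algebra_simps)
  have k21: "K21 = - u1 * \<epsilon>" using k(1,3) e by algebra
  have k22: "K22 = \<epsilon>" using k(2,4) e by algebra
  have k11: "K11 = u1 * u2 * \<epsilon> + e" using k(1) k21 e by algebra
  have k12: "K12 = - u2 * \<epsilon>" using k(2) k22 e by algebra
  have "x2 = m * K22 - q * K12" using c(1) unfolding K by algebra
  then have x2: "x2 = m * \<epsilon> + q * u2 * \<epsilon>" by (simp add: k22 k12)
  have "r = x1 * K11 - p * K21" using c(1) unfolding K by algebra
  then have r: "r = x1 * (u1 * u2 * \<epsilon> + e) + p * u1 * \<epsilon>" by (simp add: k21 k11)
  have x3: "trace (U1 ** M0 ** U2) = \<epsilon> + e + \<epsilon> * u1 * u2"
    by (simp add: U1 U2 M0 mat2_simps algebra_simps)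
  have cV: "coords_V t = vector [x1, x2, \<epsilon> + e + \<epsilon> * u1 * u2]"
    by (simp add: tt coords_V_def x3 M3 M4)
  have "x1 * x2 * (\<epsilon> + e + \<epsilon> * u1 * u2) + x1^2 + x2^2 - (a3 + \<epsilon> * a4) * x1 - (a4 + \<epsilon> * a3) * x2
      - \<epsilon> * (\<epsilon> + e + \<epsilon> * u1 * u2) + (\<epsilon>^2 + \<epsilon> * a3 * a4 + 1) = 0"
    using c(1,3,4) x2 r e by algebra
  then show "coords_V t \<in> surface (F_V \<epsilon> a3 a4)"
    unfolding cV surface_def F_V_def Let_def by simp
  define k' where "k' = inverse \<kappa>"
  have k': "\<kappa> * k' = 1" using assms by (simp add: k'_def)
  have 1: "coords_VI \<kappa> t $ 1 = k' * \<epsilon> * m + k' * \<epsilon> * u2 * q + \<kappa> * e * x1"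
    "coords_VI \<kappa> t $ 2 = \<kappa> * m + \<kappa> * p * u1 + k' * x1"
    unfolding tt coords_VI_def Let_def U1 U2 M0 M3
    by (simp_all add: mat2_simps k'_def[symmetric] algebra_simps)
  have 2: "coords_VI \<kappa> t $ 3 = \<epsilon> + e + \<epsilon> * u1 * u2"
    using k' unfolding tt coords_VI_def Let_def U1 U2 M0 M3
    by (simp add: mat2_simps k'_def[symmetric]) algebra
  have 3: "k' * \<epsilon> * m + k' * \<epsilon> * u2 * q + \<kappa> * e * x1 = \<kappa> * e * x1 + x2 * k'"
    using x2 by algebra
  have 4: "\<kappa> * m + \<kappa> * p * u1 + k' * x1
      = \<kappa> * a3 + \<kappa> * e * (a4 - x2 - x1 * (\<epsilon> + e + \<epsilon> * u1 * u2)) + x1 * k'"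
  proof -
    have "a4 - x2 - x1 * (\<epsilon> + e + \<epsilon> * u1 * u2) = \<epsilon> * (p * u1 - x1)"
      by (simp add: c(4)[symmetric] r algebra_simps)
    then have "e * (a4 - x2 - x1 * (\<epsilon> + e + \<epsilon> * u1 * u2)) = p * u1 - x1"
      using e by algebra
    then show ?thesis using c(3) by algebra
  qed
  show "coords_VI \<kappa> t = (let x = coords_V t in
           vector [\<kappa> / \<epsilon> * x$1 + x$2 / \<kappa>,
                   \<kappa> * a3 + \<kappa> / \<epsilon> * (a4 - x$2 - x$1 * x$3) + x$1 / \<kappa>,
                   x$3])"
    unfolding vec_eq_iff forall_3 1 2 3 4 Let_def cV
    by (simp add: divide_inverse e_def k'_def)
qed

lemma ex_monodromy_tuple:
  assumes "x \<in> surface (F_V \<epsilon> a3 a4)" "\<epsilon> \<noteq> 0"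
  shows "\<exists>t. monodromy_tuple \<epsilon> a3 a4 t \<and> coords_V t = x"
proof -
  define e where "e = inverse \<epsilon>"
  have e: "\<epsilon> * e = 1" using assms by (simp add: e_def)
  define x1 x2 x3 where x: "x1 = x$1" "x2 = x$2" "x3 = x$3"
  have F: "x1 * x2 * x3 + x1^2 + x2^2 - (a3 + \<epsilon> * a4) * x1 - (a4 + \<epsilon> * a3) * x2
      - \<epsilon> * x3 + (\<epsilon>^2 + \<epsilon> * a3 * a4 + 1) = 0"
    using assms(1) unfolding surface_def F_V_def Let_def x by simp
  define A B C D where ABCD: "A = e * (x3 - \<epsilon> - e)" "B = e * (a4 - x2 - x1 * x3) + x1"
    "C = e * x2 - a3 + x1" "D = (a3 - x1) * x1 - 1"
  have det0: "A * D = B * C" using F e unfolding ABCD by algebra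
  have "\<exists>u1 u2 p q. u1 * u2 = A \<and> u1 * p = B \<and> q * u2 = C \<and> p * q = D"
  proof -
    consider "A \<noteq> 0" | "A = 0" "B \<noteq> 0" | "A = 0" "B = 0" by blast
    then show ?thesis
    proof cases
      case 1
      have "1 * A = A \<and> 1 * B = B \<and> C / A * A = C \<and> B * (C / A) = D"
        using 1 det0 by (auto simp: field_simps)
      then show ?thesis by blast
    next
      case 2
      have "1 * A = A \<and> 1 * B = B \<and> D / B * A = C \<and> B * (D / B) = D"
        using 2 det0 by (auto simp: field_simps)
      then show ?thesis by blast
    next
      case 3
      have "0 * C = A \<and> 0 * D = B \<and> 1 * C = C \<and> D * 1 = D"
        using 3 by auto
      then show ?thesis by blast
    qed
  qed
  then obtain u1 u2 p q where u: "u1 * u2 = A" "u1 * p = B" "q * u2 = C" "p * q = D" by blast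
  define m K11 K12 K21 K22 where K: "m = a3 - x1" "K11 = u1 * u2 * \<epsilon> + e" "K12 = - u2 * \<epsilon>"
    "K21 = - u1 * \<epsilon>" "K22 = \<epsilon>"
  define M3 M4 where M: "M3 = mat2 m p q x1"
    "M4 = mat2 (x1 * K11 - p * K21) (x1 * K12 - p * K22) (m * K21 - q * K11) (m * K22 - q * K12)"
  have d3: "m * x1 - p * q = 1" using u(4) unfolding K ABCD by algebra
  have dK: "K11 * K22 - K12 * K21 = 1" using e unfolding K by algebra
  have m22: "m * K22 - q * K12 = x2" using u(3) e unfolding K ABCD by algebra
  have tr4: "(x1 * K11 - p * K21) + (m * K22 - q * K12) = a4"
    unfolding m22 using u e unfolding K ABCD by algebra
  have tr: "trace (mat2 1 0 u1 1 ** mat2 \<epsilon> 0 0 e ** mat2 1 u2 0 1) = x3"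
  proof -
    have "trace (mat2 1 0 u1 1 ** mat2 \<epsilon> 0 0 e ** mat2 1 u2 0 1) = \<epsilon> + e + \<epsilon> * (u1 * u2)"
      by (simp add: mat2_simps algebra_simps)
    also have "\<dots> = x3" unfolding u ABCD using e by algebra
    finally show ?thesis .
  qed
  have d4: "(x1 * K11 - p * K21) * (m * K22 - q * K12) - (x1 * K12 - p * K22) * (m * K21 - q * K11) = 1"
    using d3 dK by algebra
  have M34: "M3 ** M4 = mat2 K11 K12 K21 K22"
    unfolding M mat2_simps using d3 by (intro conjI; algebra)
  have prod: "mat2 1 0 u1 1 ** mat2 \<epsilon> 0 0 e ** mat2 1 u2 0 1 ** (M3 ** M4) = mat 1"
    unfolding M34 mat2_simps K using e by (simp add: algebra_simps)
  have "det M3 = 1" "det M4 = 1" "trace M3 = a3" "trace M4 = a4"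
    using d3 d4 tr4 by (simp_all add: M mat2_simps K(1))
  then have "monodromy_tuple \<epsilon> a3 a4 (mat2 1 0 u1 1, mat2 \<epsilon> 0 0 e, mat2 1 u2 0 1, M3, M4)"
    unfolding monodromy_tuple_def case_prod_conv e_def[symmetric]
    using prod[unfolded matrix_mul_assoc] by blast
  moreover have "coords_V (mat2 1 0 u1 1, mat2 \<epsilon> 0 0 e, mat2 1 u2 0 1, M3, M4) = x"
    unfolding coords_V_def case_prod_conv tr by (simp add: vec_eq_iff forall_3 M m22 x)
  ultimately show ?thesis by blast
qed

lemma confluent_map_coords:
  assumes "monodromy_tuple \<epsilon> a3 a4 t" "\<epsilon> \<noteq> 0" "\<kappa> \<noteq> 0"
  shows "confluent_map \<kappa> \<epsilon> a3 a4 (coords_V t) = coords_VI \<kappa> t"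
  unfolding confluent_map_def
  by (rule the_equality) (use assms monodromy_tuple_coords(2) in metis)+

text \<open>
  The sign in the comparison of the two forms. By \<open>monodromy_tuple_coords\<close>, the morphism is the
  restriction of the polynomial map below. Its Jacobian determinant is
  \<open>J = x3 / \<epsilon> - \<kappa>\<^sup>2 / \<epsilon>\<^sup>2 - 1 / \<kappa>\<^sup>2\<close>, and by the following lemma it pulls \<open>F_VI\<close> back to
  \<open>- J * F_V\<close>. The form \<open>omega F\<close> is the residue of \<open>dx1 \<and> dx2 \<and> dx3 / F\<close>, so the pullback of
  \<open>omega F_VI\<close> is \<open>- omega F_V\<close>: with these normalisations of the two forms the morphism is
  symplectic when the source carries \<open>- omega F_V\<close>.
\<close>

lemma F_VI_kappa_confluent:
  assumes "\<epsilon> \<noteq> 0" "\<kappa> \<noteq> 0"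
  shows "eval3 (F_VI_kappa \<kappa> \<epsilon> a3 a4)
           (vector [\<kappa> / \<epsilon> * x$1 + x$2 / \<kappa>,
                    \<kappa> * a3 + \<kappa> / \<epsilon> * (a4 - x$2 - x$1 * x$3) + x$1 / \<kappa>,
                    x$3])
         = - (x$3 / \<epsilon> - \<kappa>^2 / \<epsilon>^2 - 1 / \<kappa>^2) * eval3 (F_V \<epsilon> a3 a4) x"
  using assms unfolding F_VI_kappa_def F_VI_def F_V_def Let_def
  by (simp add: field_simps power2_eq_square)

end

theory Submission
  imports Defs
begin

text \<open>
  Write \<open>F\<close> and \<open>G\<close> for the equations of the source and of the target. On the source the morphism
  is the restriction of an explicit polynomial self-map \<open>P\<close> of the affine space. It preserves
  \<open>x3\<close>, and for fixed \<open>x3\<close> it is affine in \<open>(x1, x2)\<close> with determinant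
  \<open>J = x3 / \<epsilon> - \<kappa>\<^sup>2 / \<epsilon>\<^sup>2 - 1 / \<kappa>\<^sup>2\<close>; moreover \<open>G \<circ> P = - J * F\<close>. This
  identity serves both halves of the claim.

  Birationality: \<open>P\<close> is an automorphism of the complement of the plane \<open>J = 0\<close>, which has the form
  \<open>x3 = c\<close>, and because \<open>J\<close> is invertible there the identity makes \<open>F (x) = 0\<close> equivalent to
  \<open>G (P x) = 0\<close>. So \<open>P\<close> restricts to an isomorphism between the parts of the two surfaces off this
  plane. These parts are dense: both equations are monic and quadratic in \<open>x2\<close>, and the roots of a
  monic quadratic depend continuously on its coefficients, so each point of a surface on the plane is
  a limit of points of the surface off the plane (\<open>dense_open_off_hyperplane\<close>).

  Two-forms: for tangent vectors \<open>v\<close>, \<open>w\<close> of a surface, the value of its two-form is the factor by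
  which the cross product of \<open>v\<close> and \<open>w\<close> differs from the gradient of the equation
  (\<open>cross_eq_omega_grad\<close>, \<open>omega_eqI\<close>). The linear map \<open>DP\<close> acts on cross products by its cofactor
  matrix, and differentiating \<open>G \<circ> P = - J * F\<close> shows that on \<open>F = 0\<close> the cofactor matrix sends the
  gradient of \<open>F\<close> at \<open>x\<close> to minus the gradient of \<open>G\<close> at \<open>P x\<close>. Hence the pullback of the form of
  \<open>G\<close> is minus the form of \<open>F\<close>.

  The differential of the morphism does not depend on the polynomial map chosen to represent it,
  because a polynomial vanishing on the source surface is a multiple of \<open>F\<close>
  (\<open>vanishing_ideal_monic_quadratic\<close>): division by the monic quadratic \<open>F\<close> leaves a remainder that is
  linear in \<open>x2\<close>, and a linear polynomial with two distinct roots is zero.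
\<close>

section \<open>Polynomials in three variables\<close>

text \<open>
  The constants and the three variables generate the ring, so structural properties of polynomials
  need no induction over the nested representation.
\<close>

lemma poly3_induct [case_names cst X1 X2 X3 add mult]:
  assumes cst: "\<And>c. P (cst c)" and X: "P X1" "P X2" "P X3"
    and add: "\<And>p q. P p \<Longrightarrow> P q \<Longrightarrow> P (p + q)"
    and mult: "\<And>p q. P p \<Longrightarrow> P q \<Longrightarrow> P (p * q)"
  shows "P p"
proof -
  have P0: "P 0" using cst[of 0] by (simp add: cst_def)
  have 3: "P [:[:r:]:]" for r
  proof (induction r)
    case (pCons a r)
    have "[:[:pCons a r:]:] = cst a + X3 * [:[:r:]:]" by (simp add: cst_def X3_def)
    then show ?case using pCons cst X add mult by metis
  qed (simp add: P0)
  have 2: "P [:r:]" for r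
  proof (induction r)
    case (pCons a r)
    have "[:pCons a r:] = [:[:a:]:] + X2 * [:r:]" by (simp add: X2_def)
    then show ?case using pCons 3 X add mult by metis
  qed (simp add: P0)
  show ?thesis
  proof (induction p)
    case (pCons a p)
    have "pCons a p = [:a:] + X1 * p" by (simp add: X1_def)
    then show ?case using pCons 2 X add mult by metis
  qed (simp add: P0)
qed

lemma continuous_on_eval3: "continuous_on S (eval3 p)"
proof (induction p rule: poly3_induct)
  case (add p q)
  then show ?case by (simp add: continuous_on_add cong: continuous_on_cong)
next
  case (mult p q)
  then show ?case by (simp add: continuous_on_mult cong: continuous_on_cong)
qed (auto intro!: continuous_intros cong: continuous_on_cong)

lemma poly_eq_0_if_const_roots:
  fixes q :: "'a::{idom,ring_char_0} poly poly"
  assumes "\<And>b. poly q [:b:] = 0"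
  shows "q = 0"
proof (rule ccontr)
  assume "q \<noteq> 0"
  then have "finite {x. poly q x = 0}" by (rule poly_roots_finite)
  moreover have "range (\<lambda>b. [:b:]) \<subseteq> {x. poly q x = 0}" using assms by auto
  moreover have "infinite (range (\<lambda>b::'a. [:b:]))"
    by (simp add: finite_image_iff inj_def infinite_UNIV_char_0)
  ultimately show False using finite_subset by blast
qed

lemma eval3_eq_0_imp_eq_0:
  assumes "\<And>x. eval3 p x = 0"
  shows "p = 0"
proof (rule ccontr)
  assume "p \<noteq> 0"
  then have "finite {x. poly p x = 0}" by (rule poly_roots_finite)
  moreover have "range (\<lambda>a. [:[:a:]:]) \<subseteq> {x. poly p x = 0}"
  proof clarify
    fix a
    have "poly (poly (poly p [:[:a:]:]) [:b:]) c = 0" for b c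
      using assms[of "vector [a, b, c]"] by (simp add: eval3_def)
    then have "poly (poly p [:[:a:]:]) [:b:] = 0" for b
      using poly_all_0_iff_0 by blast
    then show "poly p [:[:a:]:] = 0" by (rule poly_eq_0_if_const_roots)
  qed
  moreover have "infinite (range (\<lambda>a::complex. [:[:a:]:]))"
    by (simp add: finite_image_iff inj_def infinite_UNIV_char_0)
  ultimately show False using finite_subset by blast
qed

section \<open>Differentials\<close>

lemma map_poly_additive:
  assumes "\<And>a b. d (a + b) = d a + d b" "d 0 = 0"
  shows "map_poly d (p + q) = map_poly d p + map_poly d q"
  by (rule poly_eqI) (simp add: coeff_map_poly assms)

text \<open>
  The coefficients of a product are sums of products of coefficients, so a derivation of the
  coefficient ring extends coefficientwise. This is the product rule for the partial derivatives in
  the second and, applied twice, in the third variable.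
\<close>

lemma map_poly_derivation:
  fixes d :: "'a::comm_ring_1 \<Rightarrow> 'a"
  assumes add: "\<And>a b. d (a + b) = d a + d b" and 0: "d 0 = 0"
    and leibniz: "\<And>a b. d (a * b) = d a * b + a * d b"
  shows "map_poly d (p * q) = map_poly d p * q + p * map_poly d q"
proof (rule poly_eqI)
  fix n
  have sum: "d (sum f A) = (\<Sum>i\<in>A. d (f i))" for f and A :: "nat set"
    by (induction A rule: infinite_finite_induct) (simp_all add: 0 add)
  show "coeff (map_poly d (p * q)) n = coeff (map_poly d p * q + p * map_poly d q) n"
    by (simp add: coeff_map_poly 0 coeff_mult sum leibniz sum.distrib)
qed

lemmas map_pderiv_add = map_poly_additive[of pderiv, OF pderiv_add pderiv_0]

lemma pderiv_leibniz: "pderiv (p * q) = pderiv p * q + p * pderiv q"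
  by (simp add: pderiv_mult algebra_simps)

lemmas map_pderiv_leibniz = map_poly_derivation[of pderiv, OF pderiv_add pderiv_0 pderiv_leibniz]

lemma pdiff_add [simp]: "pdiff i (p + q) = pdiff i p + pdiff i q"
  by (simp add: pdiff_def pderiv_add map_pderiv_add
      map_poly_additive[of "map_poly pderiv", OF map_pderiv_add map_poly_0])

lemma pdiff_mult [simp]: "pdiff i (p * q) = pdiff i p * q + p * pdiff i q"
  by (simp add: pdiff_def pderiv_leibniz map_pderiv_leibniz
      map_poly_derivation[of "map_poly pderiv", OF map_pderiv_add map_poly_0 map_pderiv_leibniz])

lemma pdiff_cst [simp]: "pdiff i (cst c) = 0"
  by (simp add: pdiff_def cst_def map_poly_pCons pderiv_pCons)

lemma pdiff_minus [simp]: "pdiff i (- p) = - pdiff i p"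
proof -
  have "pdiff i p + pdiff i (- p) = 0"
    unfolding pdiff_add[symmetric] by (simp add: pdiff_def)
  then show ?thesis by (metis minus_unique)
qed

lemma pdiff_diff [simp]: "pdiff i (p - q) = pdiff i p - pdiff i q"
  using pdiff_add[of i p "- q"] by simp

lemma pdiff_X [simp]:
  "pdiff 1 X1 = 1" "pdiff 1 X2 = 0" "pdiff 1 X3 = 0"
  "pdiff 2 X1 = 0" "pdiff 2 X2 = 1" "pdiff 2 X3 = 0"
  "pdiff 3 X1 = 0" "pdiff 3 X2 = 0" "pdiff 3 X3 = 1"
  by (simp_all add: pdiff_def X1_def X2_def X3_def one_pCons map_poly_pCons pderiv_pCons)

lemma dpoly_multiple:
  assumes "x \<in> surface F" "v \<in> tangent_space F x"
  shows "dpoly (A * F) x v = 0"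
proof -
  have "dpoly (A * F) x v = eval3 A x * dpoly F x v"
    using assms(1) by (simp add: dpoly_def surface_def sum_distrib_left mult.assoc)
  then show ?thesis using assms(2) by (simp add: tangent_space_def)
qed

lemma dpoly_add: "dpoly (p + q) x v = dpoly p x v + dpoly q x v"
  by (simp add: dpoly_def sum.distrib algebra_simps)

section \<open>The two-form as a cross product\<close>

text \<open>
  The gradient of \<open>F\<close> spans the vectors normal to the tangent plane, so the cross product of two
  tangent vectors is a multiple of it; the three quotients that define the two-form read off the
  factor from one component each.
\<close>

lemma cross_eq_omega_grad:
  assumes x: "x \<in> smooth_points F" and v: "v \<in> tangent_space F x" and w: "w \<in> tangent_space F x"
  shows "v$2 * w$3 - v$3 * w$2 = omega F x v w * eval3 (pdiff 1 F) x"
    and "v$3 * w$1 - v$1 * w$3 = omega F x v w * eval3 (pdiff 2 F) x"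
    and "v$1 * w$2 - v$2 * w$1 = omega F x v w * eval3 (pdiff 3 F) x"
proof -
  define a b c where abc: "a = eval3 (pdiff 1 F) x" "b = eval3 (pdiff 2 F) x" "c = eval3 (pdiff 3 F) x"
  have "a * v$1 + b * v$2 + c * v$3 = 0" "a * w$1 + b * w$2 + c * w$3 = 0"
    using v w unfolding tangent_space_def dpoly_def abc by (simp_all add: sum_3)
  then have *: "c * (v$2 * w$3 - v$3 * w$2) = a * (v$1 * w$2 - v$2 * w$1)"
    "b * (v$2 * w$3 - v$3 * w$2) = a * (v$3 * w$1 - v$1 * w$3)"
    "c * (v$3 * w$1 - v$1 * w$3) = b * (v$1 * w$2 - v$2 * w$1)"
    by algebra+
  have "a \<noteq> 0 \<or> b \<noteq> 0 \<or> c \<noteq> 0"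
    using x unfolding smooth_points_def abc by (auto simp: exhaust_3) (metis exhaust_3)
  with * show "v$2 * w$3 - v$3 * w$2 = omega F x v w * eval3 (pdiff 1 F) x"
    "v$3 * w$1 - v$1 * w$3 = omega F x v w * eval3 (pdiff 2 F) x"
    "v$1 * w$2 - v$2 * w$1 = omega F x v w * eval3 (pdiff 3 F) x"
    unfolding omega_def abc[symmetric] by (auto simp: field_simps)
qed

lemma omega_eqI:
  assumes x: "x \<in> smooth_points F"
    and "v$2 * w$3 - v$3 * w$2 = l * eval3 (pdiff 1 F) x"
    and "v$3 * w$1 - v$1 * w$3 = l * eval3 (pdiff 2 F) x"
    and "v$1 * w$2 - v$2 * w$1 = l * eval3 (pdiff 3 F) x"
  shows "omega F x v w = l"
proof -
  obtain i where "eval3 (pdiff i F) x \<noteq> 0" using x by (auto simp: smooth_points_def)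
  then have "eval3 (pdiff 1 F) x \<noteq> 0 \<or> eval3 (pdiff 2 F) x \<noteq> 0 \<or> eval3 (pdiff 3 F) x \<noteq> 0"
    using exhaust_3[of i] by auto
  then show ?thesis using assms(2-4) by (auto simp: omega_def)
qed

section \<open>Surfaces that are monic and quadratic in the second variable\<close>

text \<open>
  Independence of the second variable is expressed through values: closure under the ring operations
  is then immediate, and values are what the root arguments below use.
\<close>

definition free_of_X2 :: "poly3 \<Rightarrow> bool" where
  "free_of_X2 p \<longleftrightarrow> (\<forall>x y. x$1 = y$1 \<longrightarrow> x$3 = y$3 \<longrightarrow> eval3 p x = eval3 p y)"

lemma free_of_X2_intros [intro, simp]:
  "free_of_X2 0" "free_of_X2 1" "free_of_X2 (cst c)" "free_of_X2 X1" "free_of_X2 X3"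
  "free_of_X2 p \<Longrightarrow> free_of_X2 q \<Longrightarrow> free_of_X2 (p + q)"
  "free_of_X2 p \<Longrightarrow> free_of_X2 q \<Longrightarrow> free_of_X2 (p - q)"
  "free_of_X2 p \<Longrightarrow> free_of_X2 q \<Longrightarrow> free_of_X2 (p * q)"
  "free_of_X2 p \<Longrightarrow> free_of_X2 (p ^ n)"
  unfolding free_of_X2_def eval3_simps by metis+

text \<open>
  The remainders \<open>R * X2 + S\<close> are closed under multiplication modulo \<open>F\<close>, since
  \<open>X2\<^sup>2\<close> is congruent to \<open>- B * X2 - C\<close>.
\<close>

lemma division_by_monic_quadratic:
  assumes F: "F = X2^2 + B * X2 + C" and BC: "free_of_X2 B" "free_of_X2 C"
  shows "\<exists>A R S. p = A * F + R * X2 + S \<and> free_of_X2 R \<and> free_of_X2 S"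
proof (induction p rule: poly3_induct)
  case (cst c)
  have "cst c = 0 * F + 0 * X2 + cst c" by simp
  then show ?case by blast
next
  case X1
  have "X1 = 0 * F + 0 * X2 + X1" by simp
  then show ?case by blast
next
  case X2
  have "X2 = 0 * F + 1 * X2 + 0" by simp
  then show ?case by blast
next
  case X3
  have "X3 = 0 * F + 0 * X2 + X3" by simp
  then show ?case by blast
next
  case (add p q)
  then obtain A R S A' R' S' where
    *: "p = A * F + R * X2 + S" "q = A' * F + R' * X2 + S'"
    and "free_of_X2 R" "free_of_X2 S" "free_of_X2 R'" "free_of_X2 S'" by metis
  moreover have "p + q = (A + A') * F + (R + R') * X2 + (S + S')" unfolding * by algebra
  ultimately show ?case using free_of_X2_intros(6) by blast
next
  case (mult p q)
  then obtain A R S A' R' S' where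
    *: "p = A * F + R * X2 + S" "q = A' * F + R' * X2 + S'"
    and fr: "free_of_X2 R" "free_of_X2 S" "free_of_X2 R'" "free_of_X2 S'" by metis
  have "p * q = (A * q + R * X2 * A' + S * A' + R * R') * F
      + (R * S' + S * R' - R * R' * B) * X2 + (S * S' - R * R' * C)"
    unfolding *(1) unfolding *(2) F by algebra
  moreover have "free_of_X2 (R * S' + S * R' - R * R' * B)" "free_of_X2 (S * S' - R * R' * C)"
    using fr BC by auto
  ultimately show ?case by blast
qed

text \<open>
  Where the discriminant is nonzero, the equation has two distinct roots \<open>x2\<close> over \<open>(x1, x3)\<close>, and
  the remainder \<open>R * X2 + S\<close> of \<open>p\<close> vanishes at both; so \<open>R\<close> and \<open>S\<close> vanish there. Therefore the
  products of the discriminant with \<open>R\<close> and with \<open>S\<close> vanish everywhere, and the ring has no zero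
  divisors.
\<close>

lemma vanishing_ideal_monic_quadratic:
  assumes F: "F = X2^2 + B * X2 + C" and BC: "free_of_X2 B" "free_of_X2 C"
    and disc: "B^2 - cst 4 * C \<noteq> 0" and p: "\<And>x. x \<in> surface F \<Longrightarrow> eval3 p x = 0"
  shows "\<exists>A. p = A * F"
proof -
  obtain A R S where pe: "p = A * F + R * X2 + S" and fr: "free_of_X2 R" "free_of_X2 S"
    using division_by_monic_quadratic[OF F BC] by blast
  have *: "eval3 ((B^2 - cst 4 * C) * R) x = 0 \<and> eval3 ((B^2 - cst 4 * C) * S) x = 0" for x
  proof -
    define b c r s where bcrs: "b = eval3 B x" "c = eval3 C x" "r = eval3 R x" "s = eval3 S x"
    have lin: "r * z + s = 0" if z: "z^2 + b * z + c = 0" for z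
    proof -
      define y where "y = (vector [x$1, z, x$3] :: complex^3)"
      have y: "y$1 = x$1" "y$2 = z" "y$3 = x$3" by (simp_all add: y_def)
      have ev: "eval3 B y = b" "eval3 C y = c" "eval3 R y = r" "eval3 S y = s"
        using BC fr y unfolding free_of_X2_def bcrs by blast+
      have F0: "eval3 F y = 0" using z unfolding F by (simp add: ev y)
      then have "eval3 p y = 0" by (intro p) (simp add: surface_def)
      then show ?thesis unfolding pe by (simp add: F0 ev y)
    qed
    define d where "d = csqrt (b^2 - 4 * c)"
    have d: "d^2 = b^2 - 4 * c" by (simp add: d_def)
    then have c: "c = (b^2 - d^2) / 4" by simp
    have 1: "r * ((d - b) / 2) + s = 0"
      by (rule lin) (simp add: c field_simps power2_eq_square)
    have 2: "r * ((- d - b) / 2) + s = 0"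
      by (rule lin) (simp add: c field_simps power2_eq_square)
    have "r * d = r * ((d - b) / 2) + s - (r * ((- d - b) / 2) + s)" by (simp add: field_simps)
    then have rd: "r * d = 0" unfolding 1 2 by simp
    then have "d^2 * r = 0" by auto
    moreover have "d^2 * s = 0" using rd 1 by (cases "d = 0") auto
    ultimately show ?thesis by (simp add: bcrs[symmetric] d)
  qed
  have "(B^2 - cst 4 * C) * R = 0" "(B^2 - cst 4 * C) * S = 0"
    using * eval3_eq_0_imp_eq_0 by blast+
  then have "R = 0" "S = 0" using disc by auto
  then show ?thesis using pe by auto
qed

text \<open>
  The modulus of a monic quadratic at \<open>z\<close> is the product of the distances from \<open>z\<close> to its two roots,
  so it bounds the square of the smaller distance.
\<close>

lemma monic_quadratic_root_near:
  fixes b c z :: complex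
  shows "\<exists>r. r^2 + b * r + c = 0 \<and> norm (r - z)^2 \<le> norm (z^2 + b * z + c)"
proof -
  define d where "d = csqrt (b^2 - 4 * c)"
  have d: "d^2 = b^2 - 4 * c" by (simp add: d_def)
  then have c: "c = (b^2 - d^2) / 4" by simp
  define r1 r2 where r: "r1 = (d - b) / 2" "r2 = (- d - b) / 2"
  have roots: "r1^2 + b * r1 + c = 0" "r2^2 + b * r2 + c = 0"
    by (simp_all add: r c field_simps power2_eq_square)
  have "z^2 + b * z + c = (r1 - z) * (r2 - z)"
    by (simp add: r c field_simps power2_eq_square)
  then have n: "norm (z^2 + b * z + c) = norm (r1 - z) * norm (r2 - z)" by (simp add: norm_mult)
  show ?thesis
  proof (cases "norm (r1 - z) \<le> norm (r2 - z)")
    case True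
    then have "norm (r1 - z)^2 \<le> norm (z^2 + b * z + c)"
      unfolding n power2_eq_square[of "norm (r1 - z)"] by (intro mult_left_mono) auto
    then show ?thesis using roots by blast
  next
    case False
    then have "norm (r2 - z)^2 \<le> norm (z^2 + b * z + c)"
      unfolding n power2_eq_square[of "norm (r2 - z)"] by (intro mult_right_mono) auto
    then show ?thesis using roots by blast
  qed
qed

lemma tendsto_vector3:
  fixes a b c :: "'a::{topological_space,zero}"
  assumes "(f \<longlongrightarrow> a) F" "(g \<longlongrightarrow> b) F" "(h \<longlongrightarrow> c) F"
  shows "((\<lambda>n. vector [f n, g n, h n] :: 'a^3) \<longlongrightarrow> vector [a, b, c]) F"
proof (rule vec_tendstoI)
  show "((\<lambda>n. (vector [f n, g n, h n] :: 'a^3) $ i) \<longlongrightarrow> vector [a, b, c] $ i) F" for i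
    using assms exhaust_3[of i] by auto
qed

text \<open>
  A point of the surface on the plane \<open>x3 = c\<close> is approached by points off the plane: keep \<open>x1\<close>, move
  the third coordinate to \<open>c + 1 / (n + 1)\<close>, and take for the second the root that is nearer to
  \<open>x2\<close>. It converges to \<open>x2\<close> because \<open>F\<close> at \<open>(x1, x2, c + 1 / (n + 1))\<close> tends to 0. The claim follows
  by continuity of \<open>p\<close> in the Euclidean topology.
\<close>

lemma eval3_eq_0_on_hyperplane_section:
  assumes F: "F = X2^2 + B * X2 + C" and BC: "free_of_X2 B" "free_of_X2 C"
    and p: "\<And>x. x \<in> surface F \<Longrightarrow> x$3 \<noteq> c \<Longrightarrow> eval3 p x = 0"
    and x: "x \<in> surface F"
  shows "eval3 p x = 0"
proof (cases "x$3 = c")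
  case True
  define t :: "nat \<Rightarrow> complex" where "t n = c + of_real (inverse (real (Suc n)))" for n
  have tlim: "t \<longlonglongrightarrow> x$3"
    unfolding t_def True
    using tendsto_add[OF tendsto_const[of c] tendsto_of_real[OF LIMSEQ_inverse_real_of_nat]] by simp
  have tne: "t n \<noteq> c" for n unfolding t_def by (simp del: of_nat_Suc)
  have xv: "vector [x$1, x$2, x$3] = x" by (simp add: vec_eq_iff forall_3)
  define z where "z n = (vector [x$1, x$2, t n] :: complex^3)" for n
  have zlim: "z \<longlonglongrightarrow> x"
    unfolding z_def
    using tendsto_vector3[OF tendsto_const[of "x$1"] tendsto_const[of "x$2"] tlim] by (simp only: xv)
  have near: "\<exists>r. eval3 F (vector [x$1, r, t n]) = 0 \<and>
      norm (r - x$2)^2 \<le> norm (eval3 F (z n))" for n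
  proof -
    define b d where "b = eval3 B (z n)" and "d = eval3 C (z n)"
    have ev: "eval3 B (vector [x$1, r, t n]) = b" "eval3 C (vector [x$1, r, t n]) = d" for r
      using BC unfolding free_of_X2_def z_def b_def d_def by simp_all
    show ?thesis
      using monic_quadratic_root_near[of b d "x$2"] by (simp add: F z_def ev)
  qed
  then obtain r where r: "\<And>n. eval3 F (vector [x$1, r n, t n]) = 0"
    "\<And>n. norm (r n - x$2)^2 \<le> norm (eval3 F (z n))" by metis
  have ev_lim: "(\<lambda>n. eval3 q (y n)) \<longlonglongrightarrow> eval3 q x" if "y \<longlonglongrightarrow> x" for q y
    using continuous_on_tendsto_compose[OF continuous_on_eval3 that, of UNIV q] by simp
  have "(\<lambda>n. norm (eval3 F (z n))) \<longlonglongrightarrow> 0"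
    using tendsto_norm[OF ev_lim[OF zlim, of F]] x by (simp add: surface_def)
  then have "(\<lambda>n. norm (r n - x$2)^2) \<longlonglongrightarrow> 0"
    by (rule tendsto_0_le[where K = 1]) (use r(2) in simp)
  then have "(\<lambda>n. norm (r n - x$2)) \<longlonglongrightarrow> 0"
    using tendsto_real_sqrt[of "\<lambda>n. norm (r n - x$2)^2" 0] by simp
  then have rlim: "r \<longlonglongrightarrow> x$2"
    by (rule LIM_zero_cancel[OF tendsto_norm_zero_cancel])
  define y where "y n = (vector [x$1, r n, t n] :: complex^3)" for n
  have ylim: "y \<longlonglongrightarrow> x"
    unfolding y_def
    using tendsto_vector3[OF tendsto_const[of "x$1"] rlim tlim] by (simp only: xv)
  have "eval3 p (y n) = 0" for n
    by (rule p) (use r(1) tne in \<open>simp_all add: y_def surface_def\<close>)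
  then have "(\<lambda>n. 0) \<longlonglongrightarrow> eval3 p x" using ev_lim[OF ylim, of p] by simp
  then show ?thesis by (simp add: LIMSEQ_const_iff)
qed (use p x in blast)

lemma openin_zariski_UNIV: "openin zariski UNIV"
  unfolding openin_zariski by (rule exI[of _ "{1}"]) (auto simp: zeros_def)

lemma dense_open_off_hyperplane:
  assumes F: "F = X2^2 + B * X2 + C" and BC: "free_of_X2 B" "free_of_X2 C"
  shows "dense_open (surface F) {x \<in> surface F. x$3 \<noteq> c}"
proof -
  let ?X = "surface F" and ?U = "{x \<in> surface F. x$3 \<noteq> c}"
  have top: "topspace zariski = UNIV" using openin_subset[OF openin_zariski_UNIV] by blast
  have "?U = ?X \<inter> - zeros {X3 - cst c}" by (auto simp: zeros_def)
  then have "openin (subtopology zariski ?X) ?U"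
    unfolding openin_subtopology openin_zariski by blast
  moreover have "subtopology zariski ?X closure_of ?U = ?X"
  proof (intro subset_antisym)
    show "subtopology zariski ?X closure_of ?U \<subseteq> ?X"
      using closure_of_subset_topspace[of "subtopology zariski ?X"] by (simp add: top)
    show "?X \<subseteq> subtopology zariski ?X closure_of ?U"
    proof
      fix x assume x: "x \<in> ?X"
      have "\<exists>y. y \<in> ?U \<and> y \<in> N" if N: "x \<in> N" "openin (subtopology zariski ?X) N" for N
      proof -
        obtain T where T: "N = - zeros T \<inter> ?X"
          using N(2) unfolding openin_subtopology openin_zariski by blast
        then obtain p where p: "p \<in> T" "eval3 p x \<noteq> 0" using N(1) by (auto simp: zeros_def)
        then obtain y where "y \<in> ?X" "y$3 \<noteq> c" "eval3 p y \<noteq> 0"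
          using eval3_eq_0_on_hyperplane_section[OF F BC _ x] by blast
        then show ?thesis using T p(1) by (auto simp: zeros_def)
      qed
      then show "x \<in> subtopology zariski ?X closure_of ?U"
        using x by (auto simp: in_closure_of top)
    qed
  qed
  ultimately show ?thesis by (simp add: dense_open_def)
qed

lemma monic_quadratic_F_V:
  fixes \<epsilon> a3 a4
  defines "B \<equiv> X1 * X3 - cst (a4 + \<epsilon> * a3)"
    and "C \<equiv> X1^2 - cst (a3 + \<epsilon> * a4) * X1 - cst \<epsilon> * X3 + cst (\<epsilon>^2 + \<epsilon> * a3 * a4 + 1)"
  shows "F_V \<epsilon> a3 a4 = X2^2 + B * X2 + C" "free_of_X2 B" "free_of_X2 C"
    "B^2 - cst 4 * C \<noteq> 0"
proof -
  show "F_V \<epsilon> a3 a4 = X2^2 + B * X2 + C"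
    unfolding F_V_def B_def C_def Let_def by algebra
  show "free_of_X2 B" "free_of_X2 C" unfolding B_def C_def by auto
  show "B^2 - cst 4 * C \<noteq> 0"
  proof
    assume D: "B^2 - cst 4 * C = 0"
    have "eval3 (B^2 - cst 4 * C) (vector [s, 0, 0]) = 0" for s by (simp add: D)
    \<comment> \<open>On the line \<open>x2 = x3 = 0\<close> the discriminant is a quadratic with leading coefficient \<open>- 4\<close>,
      hence its second difference is \<open>- 8\<close>.\<close>
    from this[of 1] this[of "- 1"] this[of 0] show False
      unfolding B_def C_def by simp algebra
  qed
qed

lemma monic_quadratic_F_VI:
  "\<exists>B C. F_VI b1 b2 b3 b4 = X2^2 + B * X2 + C \<and> free_of_X2 B \<and> free_of_X2 C"
proof -
  define \<Theta>1 \<Theta>2 \<Theta>3 \<Theta>4 where \<Theta>: "\<Theta>1 = b1 * b4 + b2 * b3" "\<Theta>2 = b2 * b4 + b3 * b1"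
    "\<Theta>3 = b3 * b4 + b1 * b2" "\<Theta>4 = b1 * b2 * b3 * b4 + (b1^2 + b2^2 + b3^2 + b4^2) - 4"
  have "F_VI b1 b2 b3 b4 = X2^2 + (X1 * X3 - cst \<Theta>2) * X2
      + (X1^2 + X3^2 - cst \<Theta>1 * X1 - cst \<Theta>3 * X3 + cst \<Theta>4)"
    unfolding F_VI_def Let_def \<Theta>[symmetric] by algebra
  moreover have "free_of_X2 (X1 * X3 - cst \<Theta>2)"
    "free_of_X2 (X1^2 + X3^2 - cst \<Theta>1 * X1 - cst \<Theta>3 * X3 + cst \<Theta>4)" by auto
  ultimately show ?thesis by blast
qed


section \<open>The confluent morphism as a polynomial map\<close>

definition confluent_poly :: "complex \<Rightarrow> complex \<Rightarrow> complex \<Rightarrow> complex \<Rightarrow> 3 \<Rightarrow> poly3" where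
  "confluent_poly \<kappa> \<epsilon> a3 a4 i =
     (if i = 1 then cst (\<kappa> / \<epsilon>) * X1 + cst (1 / \<kappa>) * X2
      else if i = 2 then cst (\<kappa> * a3) + cst (\<kappa> / \<epsilon>) * (cst a4 - X2 - X1 * X3) + cst (1 / \<kappa>) * X1
      else X3)"

lemma eval_confluent_poly:
  "eval_map (confluent_poly \<kappa> \<epsilon> a3 a4) x =
     vector [\<kappa> / \<epsilon> * x$1 + x$2 / \<kappa>,
             \<kappa> * a3 + \<kappa> / \<epsilon> * (a4 - x$2 - x$1 * x$3) + x$1 / \<kappa>,
             x$3]"
  by (simp add: vec_eq_iff forall_3 eval_map_def confluent_poly_def)

lemma confluent_map_eq:
  assumes "\<epsilon> \<noteq> 0" "\<kappa> \<noteq> 0" "x \<in> surface (F_V \<epsilon> a3 a4)"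
  shows "confluent_map \<kappa> \<epsilon> a3 a4 x = eval_map (confluent_poly \<kappa> \<epsilon> a3 a4) x"
proof -
  obtain t where t: "monodromy_tuple \<epsilon> a3 a4 t" "coords_V t = x"
    using ex_monodromy_tuple[OF assms(3,1)] by blast
  then have "confluent_map \<kappa> \<epsilon> a3 a4 x = coords_VI \<kappa> t"
    using confluent_map_coords assms by blast
  also have "\<dots> = eval_map (confluent_poly \<kappa> \<epsilon> a3 a4) x"
    using monodromy_tuple_coords(2)[OF t(1) assms(1,2)] t(2) by (simp add: eval_confluent_poly Let_def)
  finally show ?thesis .
qed

lemma confluent_poly_F_VI:
  assumes "\<epsilon> \<noteq> 0" "\<kappa> \<noteq> 0"
  shows "eval3 (F_VI_kappa \<kappa> \<epsilon> a3 a4) (eval_map (confluent_poly \<kappa> \<epsilon> a3 a4) x)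
         = - (x$3 / \<epsilon> - \<kappa>^2 / \<epsilon>^2 - 1 / \<kappa>^2) * eval3 (F_V \<epsilon> a3 a4) x"
  unfolding eval_confluent_poly by (rule F_VI_kappa_confluent[OF assms])

lemma affine_morphism_confluent_map:
  assumes "\<epsilon> \<noteq> 0" "\<kappa> \<noteq> 0"
  shows "affine_morphism (surface (F_V \<epsilon> a3 a4)) (surface (F_VI_kappa \<kappa> \<epsilon> a3 a4))
           (confluent_map \<kappa> \<epsilon> a3 a4)"
  using confluent_map_eq[OF assms] confluent_poly_F_VI[OF assms]
  unfolding affine_morphism_def by (auto simp: surface_def)

section \<open>Birationality\<close>

lemma regular_funI:
  assumes "\<And>w. w \<in> V \<Longrightarrow> eval3 h w \<noteq> 0 \<and> f w = eval3 g w / eval3 h w"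
  shows "regular_fun V f"
proof -
  have "openin (subtopology zariski V) V"
    unfolding openin_subtopology using openin_zariski_UNIV by blast
  then show ?thesis unfolding regular_fun_def using assms by blast
qed

text \<open>
  The exceptional set is the plane \<open>J = 0\<close> in both spaces; off it the inverse is given by Cramer's rule.
\<close>

lemma birational_confluent_map:
  assumes nz: "\<epsilon> \<noteq> 0" "\<kappa> \<noteq> 0"
  shows "birational (surface (F_V \<epsilon> a3 a4)) (surface (F_VI_kappa \<kappa> \<epsilon> a3 a4))
           (confluent_map \<kappa> \<epsilon> a3 a4)"
proof -
  let ?X = "surface (F_V \<epsilon> a3 a4)" and ?Y = "surface (F_VI_kappa \<kappa> \<epsilon> a3 a4)"
  let ?f = "confluent_map \<kappa> \<epsilon> a3 a4" and ?P = "eval_map (confluent_poly \<kappa> \<epsilon> a3 a4)"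
  \<comment> \<open>Inverses as variables, subject to the relations \<open>ke\<close>, turn the identities into polynomial ones.\<close>
  define k' e where "k' = 1 / \<kappa>" and "e = 1 / \<epsilon>"
  have ke: "\<kappa> * k' = 1" "\<epsilon> * e = 1" using nz by (simp_all add: k'_def e_def)
  define c where "c = \<epsilon> * (\<kappa>^2 * e^2 + k'^2)"
  define U where "U = {x \<in> ?X. x$3 \<noteq> c}"
  define V where "V = {x \<in> ?Y. x$3 \<noteq> c}"
  define J :: poly3 where "J = cst e * X3 - cst (\<kappa>^2 * e^2 + k'^2)"
  have J0: "eval3 J x = 0 \<longleftrightarrow> x$3 = c" for x
  proof -
    have "eval3 J x = e * (x$3 - c)" unfolding J_def c_def using ke by simp algebra
    then show ?thesis using ke by auto
  qed
  have J: "eval3 J x = x$3 / \<epsilon> - \<kappa>^2 / \<epsilon>^2 - 1 / \<kappa>^2" for x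
    by (simp add: J_def e_def k'_def field_simps)
  \<comment> \<open>For a given third coordinate, the first two components of the morphism are affine in the first
    two coordinates, with determinant \<open>J\<close>; these are the numerators of Cramer's rule.\<close>
  define S where "S = X2 - cst (\<kappa> * a3 + \<kappa> * e * a4)"
  define N1 where "N1 = - cst (\<kappa> * e) * X1 - cst k' * S"
  define N2 where "N2 = cst (\<kappa> * e) * S - (cst k' - cst (\<kappa> * e) * X3) * X1"
  define g :: "complex^3 \<Rightarrow> complex^3"
    where "g y = vector [eval3 N1 y / eval3 J y, eval3 N2 y / eval3 J y, y$3]" for y
  have P: "?P x = vector [\<kappa> * e * x$1 + k' * x$2,
      \<kappa> * a3 + \<kappa> * e * (a4 - x$2 - x$1 * x$3) + k' * x$1, x$3]" for x
    by (simp add: eval_confluent_poly e_def k'_def)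
  have gP: "g (?P x) = x" if "x$3 \<noteq> c" for x
  proof -
    have j: "eval3 J x \<noteq> 0" using that J0 by blast
    have jP: "eval3 J (?P x) = eval3 J x" by (simp add: P J_def)
    have "eval3 N1 (?P x) = eval3 J x * x$1"
      unfolding N1_def S_def J_def by (simp add: P) (use ke in algebra)
    moreover have "eval3 N2 (?P x) = eval3 J x * x$2"
      unfolding N2_def S_def J_def by (simp add: P) (use ke in algebra)
    ultimately show ?thesis using j by (simp add: g_def vec_eq_iff forall_3 jP) (simp add: P)
  qed
  have Pg: "?P (g y) = y" if "y$3 \<noteq> c" for y
  proof -
    define j where "j = eval3 J y"
    have j: "j \<noteq> 0" using that J0 unfolding j_def by blast
    have 1: "j * g y $ 1 = eval3 N1 y" "j * g y $ 2 = eval3 N2 y" "g y $ 3 = y $ 3"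
      using j by (simp_all add: g_def j_def)
    have je: "j = e * y$3 - (\<kappa>^2 * e^2 + k'^2)" by (simp add: j_def J_def)
    have "j * (\<kappa> * e * g y$1 + k' * g y$2) = j * y$1"
      using 1 ke unfolding je N1_def N2_def S_def by simp algebra
    moreover have "j * (\<kappa> * a3 + \<kappa> * e * (a4 - g y$2 - g y$1 * y$3) + k' * g y$1) = j * y$2"
      using 1 ke unfolding je N1_def N2_def S_def by simp algebra
    ultimately show ?thesis using j by (simp add: P vec_eq_iff forall_3 1(3))
  qed
  have PX: "?P x \<in> ?Y \<longleftrightarrow> x \<in> ?X" if "x$3 \<noteq> c" for x
    using confluent_poly_F_VI[OF nz, of a3 a4 x] that J0[of x] unfolding J[symmetric]
    by (simp add: surface_def)
  have f: "?f x = ?P x" if "x \<in> U" for x using that confluent_map_eq[OF nz] by (simp add: U_def)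
  have P3: "?P x $ 3 = x $ 3" and g3: "g x $ 3 = x $ 3" for x by (simp_all add: P g_def)
  have fU: "?f ` U \<subseteq> V" using f PX by (auto simp: V_def U_def P3)
  have gV: "g ` V \<subseteq> U"
  proof clarify
    fix y assume y: "y \<in> V"
    then have "?P (g y) \<in> ?Y" "g y $ 3 \<noteq> c" using Pg by (auto simp: V_def g3)
    then show "g y \<in> U" using PX by (auto simp: U_def)
  qed
  have "regular_map U V ?f"
    unfolding regular_map_def
  proof (intro conjI fU allI)
    show "regular_fun U (\<lambda>x. ?f x $ i)" for i
      by (rule regular_funI[of _ 1 _ "confluent_poly \<kappa> \<epsilon> a3 a4 i"]) (simp add: f eval_map_def)
  qed
  moreover have "regular_map V U g"
    unfolding regular_map_def forall_3
  proof (intro conjI gV)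
    have nz': "eval3 J y \<noteq> 0" if "y \<in> V" for y using that J0 by (auto simp: V_def)
    show "regular_fun V (\<lambda>y. g y $ 1)"
      by (rule regular_funI[of _ J _ N1]) (use nz' in \<open>simp add: g_def\<close>)
    show "regular_fun V (\<lambda>y. g y $ 2)"
      by (rule regular_funI[of _ J _ N2]) (use nz' in \<open>simp add: g_def\<close>)
    show "regular_fun V (\<lambda>y. g y $ 3)" by (rule regular_funI[of _ 1 _ X3]) (simp add: g_def)
  qed
  moreover have "dense_open ?X U"
    unfolding U_def by (rule dense_open_off_hyperplane[OF monic_quadratic_F_V(1-3)])
  moreover have "dense_open ?Y V"
  proof -
    obtain B C where "F_VI_kappa \<kappa> \<epsilon> a3 a4 = X2^2 + B * X2 + C" "free_of_X2 B" "free_of_X2 C"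
      using monic_quadratic_F_VI unfolding F_VI_kappa_def by blast
    then show ?thesis unfolding V_def by (rule dense_open_off_hyperplane)
  qed
  moreover have "\<forall>x\<in>U. g (?f x) = x" using f gP by (simp add: U_def)
  moreover have "\<forall>y\<in>V. ?f (g y) = y" using f gV Pg by (auto simp: V_def)
  ultimately show ?thesis unfolding birational_def by blast
qed

section \<open>The pullback of the two-form\<close>

text \<open>
  Two polynomial maps that agree on the surface differ by multiples of its equation, and the
  differentials of such multiples vanish on tangent vectors.
\<close>

lemma dpoly_map_unique:
  assumes PQ: "\<And>y. y \<in> surface (F_V \<epsilon> a3 a4) \<Longrightarrow> eval_map P y = eval_map Q y"
    and x: "x \<in> surface (F_V \<epsilon> a3 a4)" and v: "v \<in> tangent_space (F_V \<epsilon> a3 a4) x"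
  shows "dpoly_map P x v = dpoly_map Q x v"
proof -
  have "dpoly (P i) x v = dpoly (Q i) x v" for i
  proof -
    have "eval3 (P i - Q i) y = 0" if "y \<in> surface (F_V \<epsilon> a3 a4)" for y
      using PQ[OF that] by (simp add: eval_map_def vec_eq_iff)
    then obtain A where "P i - Q i = A * F_V \<epsilon> a3 a4"
      using vanishing_ideal_monic_quadratic[OF monic_quadratic_F_V] by blast
    then have "P i = Q i + A * F_V \<epsilon> a3 a4" by (simp add: algebra_simps)
    then show ?thesis by (simp add: dpoly_add dpoly_multiple[OF x v])
  qed
  then show ?thesis by (simp add: dpoly_map_def)
qed

lemma eval3_2: "eval3 2 x = 2"
  by (metis eval3_simps(2,3) one_add_one)

lemma pdiff_F_V:
  "eval3 (pdiff 1 (F_V \<epsilon> a3 a4)) x = x$2 * x$3 + 2 * x$1 - (a3 + \<epsilon> * a4)"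
  "eval3 (pdiff 2 (F_V \<epsilon> a3 a4)) x = x$1 * x$3 + 2 * x$2 - (a4 + \<epsilon> * a3)"
  "eval3 (pdiff 3 (F_V \<epsilon> a3 a4)) x = x$1 * x$2 - \<epsilon>"
  by (simp_all add: F_V_def Let_def power2_eq_square eval3_2)

lemma pdiff_F_VI:
  "eval3 (pdiff 1 (F_VI b1 b2 b3 b4)) x = x$2 * x$3 + 2 * x$1 - (b1 * b4 + b2 * b3)"
  "eval3 (pdiff 2 (F_VI b1 b2 b3 b4)) x = x$1 * x$3 + 2 * x$2 - (b2 * b4 + b3 * b1)"
  "eval3 (pdiff 3 (F_VI b1 b2 b3 b4)) x = x$1 * x$2 + 2 * x$3 - (b3 * b4 + b1 * b2)"
  by (simp_all add: F_VI_def Let_def power2_eq_square eval3_2)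

lemma dpoly_map_confluent_poly:
  "dpoly_map (confluent_poly \<kappa> \<epsilon> a3 a4) x v =
     vector [\<kappa> / \<epsilon> * v$1 + v$2 / \<kappa>,
             (1 / \<kappa> - \<kappa> / \<epsilon> * x$3) * v$1 - \<kappa> / \<epsilon> * v$2 - \<kappa> / \<epsilon> * x$1 * v$3,
             v$3]"
  by (simp add: vec_eq_iff forall_3 dpoly_map_def dpoly_def sum_3 confluent_poly_def algebra_simps)

text \<open>
  With \<open>e3\<close> the third unit vector, the identity behind the three component computations is
  \<open>cof (DP) (grad F) + (grad G) \<circ> P = - (F / \<epsilon>) e3\<close>. To find it, differentiate
  \<open>G \<circ> P = - J * F\<close> and multiply by the inverse of the transpose of \<open>DP\<close>. The result is
  polynomial, so it also holds where \<open>J = 0\<close>.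
\<close>

lemma symplectic_confluent_map:
  assumes nz: "\<epsilon> \<noteq> 0" "\<kappa> \<noteq> 0"
  shows "symplectic_map (F_V \<epsilon> a3 a4) (\<lambda>x v w. - omega (F_V \<epsilon> a3 a4) x v w)
     (F_VI_kappa \<kappa> \<epsilon> a3 a4) (omega (F_VI_kappa \<kappa> \<epsilon> a3 a4)) (confluent_map \<kappa> \<epsilon> a3 a4)"
  unfolding symplectic_map_def
proof (intro allI impI)
  let ?F = "F_V \<epsilon> a3 a4" and ?G = "F_VI_kappa \<kappa> \<epsilon> a3 a4"
  let ?Q = "confluent_poly \<kappa> \<epsilon> a3 a4"
  fix P x v w
  assume P: "\<forall>y\<in>surface ?F. confluent_map \<kappa> \<epsilon> a3 a4 y = eval_map P y"
    and x: "x \<in> smooth_points ?F" and fx: "confluent_map \<kappa> \<epsilon> a3 a4 x \<in> smooth_points ?G"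
    and v: "v \<in> tangent_space ?F x" and w: "w \<in> tangent_space ?F x"
  have xF: "x \<in> surface ?F" using x by (simp add: smooth_points_def)
  have Q: "confluent_map \<kappa> \<epsilon> a3 a4 y = eval_map ?Q y" if "y \<in> surface ?F" for y
    using confluent_map_eq[OF nz that] .
  have dP: "dpoly_map P x z = dpoly_map ?Q x z" if "z \<in> tangent_space ?F x" for z
    by (rule dpoly_map_unique[OF _ xF that]) (use P Q in simp)
  \<comment> \<open>Inverses as variables, subject to the relations \<open>ke\<close>, turn the identities into polynomial ones.\<close>
  define k' e where "k' = 1 / \<kappa>" and "e = 1 / \<epsilon>"
  have ke: "\<kappa> * k' = 1" "\<epsilon> * e = 1" using nz by (simp_all add: k'_def e_def)
  define l where "l = omega ?F x v w"
  define y where "y = eval_map ?Q x"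
  define p q where "p = dpoly_map ?Q x v" and "q = dpoly_map ?Q x w"
  have y: "y$1 = \<kappa> * e * x$1 + k' * x$2"
    "y$2 = \<kappa> * a3 + \<kappa> * e * (a4 - x$2 - x$1 * x$3) + k' * x$1" "y$3 = x$3"
    by (simp_all add: y_def eval_confluent_poly k'_def e_def)
  have p: "p$1 = \<kappa> * e * v$1 + k' * v$2"
    "p$2 = (k' - \<kappa> * e * x$3) * v$1 - \<kappa> * e * v$2 - \<kappa> * e * x$1 * v$3" "p$3 = v$3"
    by (simp_all add: p_def dpoly_map_confluent_poly k'_def e_def)
  have q: "q$1 = \<kappa> * e * w$1 + k' * w$2"
    "q$2 = (k' - \<kappa> * e * x$3) * w$1 - \<kappa> * e * w$2 - \<kappa> * e * x$1 * w$3" "q$3 = w$3"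
    by (simp_all add: q_def dpoly_map_confluent_poly k'_def e_def)
  have F0: "x$1 * x$2 * x$3 + x$1^2 + x$2^2 - (a3 + \<epsilon> * a4) * x$1 - (a4 + \<epsilon> * a3) * x$2 - \<epsilon> * x$3
      + (\<epsilon>^2 + \<epsilon> * a3 * a4 + 1) = 0"
    using xF by (simp add: surface_def F_V_def Let_def)
  have G: "eval3 (pdiff 1 ?G) y = y$2 * y$3 + 2 * y$1 - ((\<kappa> + k') * a4 + (\<epsilon> * k' + e * \<kappa>) * a3)"
    "eval3 (pdiff 2 ?G) y = y$1 * y$3 + 2 * y$2 - ((\<epsilon> * k' + e * \<kappa>) * a4 + a3 * (\<kappa> + k'))"
    "eval3 (pdiff 3 ?G) y = y$1 * y$2 + 2 * y$3 - (a3 * a4 + (\<kappa> + k') * (\<epsilon> * k' + e * \<kappa>))"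
    by (simp_all add: F_VI_kappa_def pdiff_F_VI k'_def e_def inverse_eq_divide)
  note cross = cross_eq_omega_grad[OF x v w, folded l_def, unfolded pdiff_F_V]
  define A B C where ABC: "A = v$2 * w$3 - v$3 * w$2" "B = v$3 * w$1 - v$1 * w$3"
    "C = v$1 * w$2 - v$2 * w$1"
  note cross = cross[folded ABC]
  have "p$2 * q$3 - p$3 * q$2 = - (k' - \<kappa> * e * x$3) * B - \<kappa> * e * A"
    unfolding p q ABC by algebra
  also have "\<dots> = - l * eval3 (pdiff 1 ?G) y"
    unfolding cross G y using ke by algebra
  finally have c1: "p$2 * q$3 - p$3 * q$2 = - l * eval3 (pdiff 1 ?G) y" .
  have "p$3 * q$1 - p$1 * q$3 = \<kappa> * e * B - k' * A"
    unfolding p q ABC by algebra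
  also have "\<dots> = - l * eval3 (pdiff 2 ?G) y"
    unfolding cross G y using ke by algebra
  finally have c2: "p$3 * q$1 - p$1 * q$3 = - l * eval3 (pdiff 2 ?G) y" .
  have "p$1 * q$2 - p$2 * q$1
      = (e * x$3 - \<kappa>^2 * e^2 - k'^2) * C + \<kappa>^2 * e^2 * x$1 * B - e * x$1 * A"
    unfolding p q ABC using ke by algebra
  also have "\<dots> = - l * eval3 (pdiff 3 ?G) y"
    unfolding cross G y using ke F0 by algebra
  finally have c3: "p$1 * q$2 - p$2 * q$1 = - l * eval3 (pdiff 3 ?G) y" .
  have "y \<in> smooth_points ?G" using fx Q[OF xF] by (simp add: y_def)
  then have "omega ?G y p q = - l" by (rule omega_eqI[OF _ c1 c2 c3])
  then show "omega ?G (confluent_map \<kappa> \<epsilon> a3 a4 x) (dpoly_map P x v) (dpoly_map P x w)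
      = - omega ?F x v w"
    using dP v w Q[OF xF] by (simp add: l_def y_def p_def q_def)
qed

theorem theorem3p35:
  fixes e0 e3 e4 \<kappa> \<epsilon> a3 a4 :: complex
  assumes "e0 \<noteq> 0" "e3 \<noteq> 0" "e4 \<noteq> 0"
    and "e0 \<noteq> 1" "e0 \<noteq> -1" "e3 \<noteq> 1" "e3 \<noteq> -1" "e4 \<noteq> 1" "e4 \<noteq> -1"
    and "\<forall>\<epsilon>3\<in>{1, -1 :: int}. \<forall>\<epsilon>4\<in>{1, -1 :: int}. e0 * e3 powi \<epsilon>3 * e4 powi \<epsilon>4 \<noteq> 1"
    and "\<kappa> \<noteq> 0"
    and "\<epsilon> = e0 \<or> \<epsilon> = inverse e0"
    and "a3 = e3 + inverse e3" "a4 = e4 + inverse e4"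
  shows "symplectic_birational_morphism
           (F_V \<epsilon> a3 a4) (\<lambda>x v w. - omega (F_V \<epsilon> a3 a4) x v w)
           (F_VI_kappa \<kappa> \<epsilon> a3 a4) (omega (F_VI_kappa \<kappa> \<epsilon> a3 a4))
           (confluent_map \<kappa> \<epsilon> a3 a4)"
proof -
  have "\<epsilon> \<noteq> 0" using assms(1,12) by auto
  then show ?thesis
    unfolding symplectic_birational_morphism_def
    using affine_morphism_confluent_map birational_confluent_map symplectic_confluent_map \<open>\<kappa> \<noteq> 0\<close>
    by blast
qed

end
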